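(* Let $q=p^m$, where $m$ is a positive integer and $p$ is an odd prime. Then $$f_5(X)=2X^{q^2}+X^{q^2-q+1}+X^{q^2+q-1}$$ is a permutation polynomial over $\mathbb{F}_{q^3}$, and its compositional inverse over $\mathbb{F}_{q^3}$ is $$f_5^{-1}(X)=\frac{-X+X^q-X^{q^2}+2X^{\frac{q^2+1}{2}}}{4}.$$
   Context: A polynomial $f\in\mathbb{F}_{Q}[X]$ is a permutation polynomial over $\mathbb{F}_Q$ if $c\mapsto f(c)$ is a bijection of $\mathbb{F}_Q$; its compositional inverse is the polynomial $f^{-1}$ with $f(f^{-1}(x))=f^{-1}(f(x))=x$ for all $x\in\mathbb{F}_Q$. *)

theory Defs
  imports
    "HOL-Computational_Algebra.Polynomial"
    "HOL-Computational_Algebra.Primes"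
    "HOL-Library.Cardinality"
begin

text \<open>The finite field \<open>F\<^sub>Q\<close> is an arbitrary type of sort \<open>{field, finite}\<close> with \<open>Q\<close> elements.\<close>

definition permutation_poly :: "'a::{field,finite} poly \<Rightarrow> bool" where
  "permutation_poly f \<longleftrightarrow> bij (poly f)"

text \<open>The inverse is taken with respect to evaluation on the field, not composition in the
  polynomial ring, so it is determined only modulo \<open>X\<^sup>Q - X\<close>.\<close>

definition compositional_inverse :: "'a::{field,finite} poly \<Rightarrow> 'a poly \<Rightarrow> bool" where
  "compositional_inverse f g \<longleftrightarrow> (\<forall>x. poly f (poly g x) = x \<and> poly g (poly f x) = x)"

definition f5 :: "nat \<Rightarrow> 'a::{field,finite} poly" where
  "f5 q = monom 2 (q^2) + monom 1 (q^2 - q + 1) + monom 1 (q^2 + q - 1)"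

text \<open>For odd \<open>q\<close> the division in the exponent is exact, and \<open>4\<close> is invertible in the field.\<close>

definition f5_inv :: "nat \<Rightarrow> 'a::{field,finite} poly" where
  "f5_inv q =
     smult (1 / 4) (- monom 1 1 + monom 1 q - monom 1 (q^2) + monom 2 ((q^2 + 1) div 2))"

end

theory Submission
  imports Defs "HOL-Number_Theory.Residues"
begin

text \<open>For \<open>x \<noteq> 0\<close> put \<open>y = x^q\<close> and \<open>z = x^(q\<^sup>2)\<close>, so that \<open>z^q = x\<close>. Then
  \<open>f\<^sub>5(x) = z (x + y)\<^sup>2 / (x y)\<close> is a square up to the factor \<open>z / (x y)\<close>, whose
  \<open>(q\<^sup>2 + 1) / 2\<close>-th power is \<open>1 / x\<close>. Hence the half power in the inverse evaluates to
  \<open>(x + y) (z + x) / x\<close>, and the claimed inverse becomes a rational identity in \<open>x\<close>, \<open>y\<close>, \<open>z\<close>.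
  A left inverse on a finite set is an inverse.\<close>

text \<open>The library version needs the class \<open>finite_field\<close>, which is not inferred from
  \<open>{field, finite}\<close>.\<close>

lemma power_CARD_eq_self:
  fixes x :: "'a::{field,finite}"
  shows "x ^ CARD('a) = x"
proof (cases "x = 0")
  case False
  let ?P = "\<Prod>y\<in>UNIV-{0::'a}. y"
  have "?P = (\<Prod>y\<in>UNIV-{0}. x * y)"
    by (rule prod.reindex_bij_witness[of _ "\<lambda>y. x * y" "\<lambda>y. y / x"]) (use False in auto)
  also have "\<dots> = x ^ (CARD('a) - 1) * ?P"
    by (simp add: prod.distrib card_Diff_singleton)
  finally have "x ^ (CARD('a) - 1) = 1"
    by simp
  then show ?thesis
    using power_minus_mult[of "CARD('a)" x] by simp
qed simp

lemma CHAR_eq_prime: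
  assumes "prime p" and "CARD('a::{field,finite}) = p ^ n"
  shows "CHAR('a) = p"
proof -
  have "prime CHAR('a)"
    by (rule prime_CHAR_semidom) (simp add: finite_imp_CHAR_pos)
  moreover have "CHAR('a) dvd p ^ n"
    using CHAR_dvd_CARD[where 'a='a] assms(2) by simp
  ultimately show ?thesis
    using assms(1) prime_dvd_power primes_dvd_imp_eq by blast
qed

lemma left_inverse_finite_imp_right_inverse:
  fixes f g :: "'a::finite \<Rightarrow> 'a"
  assumes "\<And>x. g (f x) = x"
  shows "bij f" and "f (g x) = x"
proof -
  have "inj f"
    by (metis assms injI)
  then have "surj f"
    by (simp add: finite_UNIV_inj_surj)
  with \<open>inj f\<close> show "bij f"
    by (simp add: bij_def)
  show "f (g x) = x"
    using assms \<open>surj f\<close> by (metis surjD)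
qed

lemma poly_f5:
  fixes x :: "'a::{field,finite}"
  assumes "x \<noteq> 0" and "q > 0"
  shows "poly (f5 q) x = x ^ (q\<^sup>2) * (x + x ^ q)\<^sup>2 / (x * x ^ q)"
proof -
  \<comment> \<open>This makes the natural-number subtraction in the exponent
    \<open>q\<^sup>2 - q + 1\<close> exact, so that it turns into division by
    \<open>x ^ q\<close>.\<close>
  have q: "q \<le> q\<^sup>2"
    using \<open>q > 0\<close> by (simp add: power2_eq_square)
  have "x ^ (q\<^sup>2 - q + 1) * x ^ q = x ^ (q\<^sup>2) * x"
    using q by (simp flip: power_add power_Suc2)
  then have 1: "x ^ (q\<^sup>2 - q + 1) = x ^ (q\<^sup>2) * x / x ^ q"
    using assms(1) by (simp add: field_simps)
  have "x ^ (q\<^sup>2 + q - 1) * x = x ^ (q\<^sup>2) * x ^ q"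
    using \<open>q > 0\<close> by (simp flip: power_add power_Suc2)
  then have 2: "x ^ (q\<^sup>2 + q - 1) = x ^ (q\<^sup>2) * x ^ q / x"
    using assms(1) by (simp add: field_simps)
  have "poly (f5 q) x = 2 * x ^ (q\<^sup>2) + x ^ (q\<^sup>2) * x / x ^ q + x ^ (q\<^sup>2) * x ^ q / x"
    unfolding f5_def poly_add poly_monom 1 2 by simp
  also have "\<dots> = x ^ (q\<^sup>2) * (x + x ^ q)\<^sup>2 / (x * x ^ q)"
    using assms(1) by (simp add: field_simps power2_eq_square)
  finally show ?thesis .
qed

lemma poly_f5_inv:
  fixes x :: "'a::{field,finite}"
  shows "poly (f5_inv q) x = (- x + x ^ q - x ^ (q\<^sup>2) + 2 * x ^ ((q\<^sup>2 + 1) div 2)) / 4"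
  by (simp add: f5_inv_def poly_monom)

text \<open>With k = (q^2 + 1)/2, the exponent satisfies (q^2 - q - 1) k + 1 = ((q - 1)/2) (q^3 -
  1), and q^3 - 1 annihilates exponents of nonzero x because x^(q^3) = x.\<close>

lemma half_power:
  fixes x :: "'a::field"
  assumes "x \<noteq> 0" and "odd q" and "x ^ (q ^ 3) = x"
  shows "(x ^ (q\<^sup>2) / (x * x ^ q)) ^ ((q\<^sup>2 + 1) div 2) = 1 / x"
proof -
  obtain n where n: "q = 2 * n + 1"
    using \<open>odd q\<close> oddE by blast
  define k where "k = (q\<^sup>2 + 1) div 2"
  have k: "k = 2 * n * n + 2 * n + 1"
    unfolding k_def n by (simp add: power2_eq_square algebra_simps)
  \<comment> \<open>The congruence modulo q^3 - 1 with its negative terms moved across, so that no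
    truncated subtraction occurs; \<open>n\<close> is (q - 1)/2.\<close>
  have exponents: "(q\<^sup>2 * k + 1) + n = (q + 1) * k + q ^ 3 * n"
    unfolding k n by (simp add: power2_eq_square power3_eq_cube algebra_simps)
  have "x ^ (q\<^sup>2 * k + 1) * x ^ n = x ^ ((q + 1) * k) * (x ^ (q ^ 3)) ^ n"
    unfolding power_mult[symmetric] power_add[symmetric] exponents ..
  then have "x ^ (q\<^sup>2 * k + 1) = x ^ ((q + 1) * k)"
    using assms(1,3) by simp
  then have "x * (x ^ (q\<^sup>2)) ^ k = (x * x ^ q) ^ k"
    by (simp add: power_add power_mult power_mult_distrib)
  then show ?thesis
    using assms(1) unfolding k_def[symmetric] by (simp add: field_simps)
qed

lemma f5_inverse_identity:
  fixes x y z :: "'a::field"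
  assumes "x \<noteq> 0" "y \<noteq> 0" "z \<noteq> 0" "(4::'a) \<noteq> 0"
  shows "(- (z * (x + y)\<^sup>2 / (x * y)) + x * (y + z)\<^sup>2 / (y * z) - y * (z + x)\<^sup>2 / (z * x)
    + 2 * ((x + y) * (z + x) / x)) / 4 = x"
proof -
  have "- (z * (x + y)\<^sup>2 / (x * y)) + x * (y + z)\<^sup>2 / (y * z) - y * (z + x)\<^sup>2 / (z * x)
      + 2 * ((x + y) * (z + x) / x)
    = (- (z * (x + y))\<^sup>2 + (x * (y + z))\<^sup>2 - (y * (z + x))\<^sup>2
      + 2 * (z * (x + y)) * (y * (z + x))) / (x * y * z)"
    using assms(1-3) by (simp add: divide_simps) (simp add: power2_eq_square algebra_simps)
  \<comment> \<open>With A = z(x + y), B = x(y + z), C = y(z + x), the left side is B^2 - (A - C)^2,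
    whose factors are B + A - C = 2xz and B - A + C = 2xy.\<close>
  also have "- (z * (x + y))\<^sup>2 + (x * (y + z))\<^sup>2 - (y * (z + x))\<^sup>2
      + 2 * (z * (x + y)) * (y * (z + x)) = 4 * x * (x * y * z)"
    by (simp add: power2_eq_square algebra_simps)
  finally show ?thesis
    using assms by simp
qed

lemma f5_inv_f5:
  fixes x :: "'a::{field,finite}"
  assumes "odd q" and frobenius: "\<And>a b :: 'a. (a + b) ^ q = a ^ q + b ^ q"
    and card: "CARD('a) = q ^ 3" and "(4::'a) \<noteq> 0"
  shows "poly (f5_inv q) (poly (f5 q) x) = x"
proof (cases "x = 0")
  \<comment> \<open>Zero is treated apart because the quotient form of \<open>f5\<close> divides by
    x. Every exponent involved is positive, so both polynomials vanish at 0.\<close>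
  case True
  from \<open>odd q\<close> have "q > 0" by (rule odd_pos)
  then have "q\<^sup>2 > 0"
    by simp
  with \<open>q > 0\<close> have "q\<^sup>2 + q - 1 > 0"
    by linarith
  with \<open>q > 0\<close> \<open>q\<^sup>2 > 0\<close> show ?thesis
    using True by (simp add: f5_def poly_f5_inv poly_monom power_0_left div_eq_0_iff)
next
  case False
  from \<open>odd q\<close> have "q > 0" by (rule odd_pos)
  define y where "y = x ^ q"
  define z where "z = x ^ (q\<^sup>2)"
  define u where "u = poly (f5 q) x"
  have cube: "x ^ (q ^ 3) = x"
    using power_CARD_eq_self[of x] card by simp
  \<comment> \<open>The q-th power map is additive and multiplicative and permutes x, y, z
    cyclically, so the conjugates of \<open>u\<close> arise from its formula by shifting the
    variables.\<close>
  have xq: "x ^ q = y" and yq: "y ^ q = z" and zq: "z ^ q = x"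
    using cube by (simp_all add: y_def z_def power2_eq_square power3_eq_cube flip: power_mult)
  have nz: "x \<noteq> 0" "y \<noteq> 0" "z \<noteq> 0"
    using False by (simp_all add: y_def z_def)
  have u: "u = z * (x + y)\<^sup>2 / (x * y)"
    unfolding u_def y_def z_def using False \<open>q > 0\<close> by (rule poly_f5)
  have square_power: "(a\<^sup>2) ^ q = (a ^ q)\<^sup>2" for a :: 'a
    by (simp add: mult.commute flip: power_mult)
  have uq: "u ^ q = x * (y + z)\<^sup>2 / (y * z)"
    unfolding u by (simp add: power_divide power_mult_distrib square_power frobenius xq yq zq)
  have "u ^ (q\<^sup>2) = (u ^ q) ^ q"
    by (simp add: power2_eq_square power_mult)
  also have "\<dots> = y * (z + x)\<^sup>2 / (z * x)"
    unfolding uq by (simp add: power_divide power_mult_distrib square_power frobenius xq yq zq)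
  finally have uqq: "u ^ (q\<^sup>2) = y * (z + x)\<^sup>2 / (z * x)" .
  \<comment> \<open>The square cancels the half: (x + y)^2 is raised to (x + y)^(q^2 + 1), which is
    x + y times its second Frobenius conjugate. Nothing is divided by x + y, so it may be
    zero.\<close>
  have "2 * ((q\<^sup>2 + 1) div 2) = Suc (q\<^sup>2)"
    using \<open>odd q\<close> by simp
  then have "((x + y)\<^sup>2) ^ ((q\<^sup>2 + 1) div 2) = (x + y) * ((x + y) ^ q) ^ q"
    by (metis power_mult power_Suc power2_eq_square)
  also have "((x + y) ^ q) ^ q = z + x"
    by (simp add: frobenius xq yq zq)
  finally have "u ^ ((q\<^sup>2 + 1) div 2) = (z / (x * y)) ^ ((q\<^sup>2 + 1) div 2) * ((x + y) * (z + x))"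
    unfolding u by (simp add: power_mult_distrib power_divide)
  also have "\<dots> = (x + y) * (z + x) / x"
    using half_power[OF False \<open>odd q\<close> cube] by (simp add: y_def z_def)
  finally have uh: "u ^ ((q\<^sup>2 + 1) div 2) = (x + y) * (z + x) / x" .
  show ?thesis
    unfolding u_def[symmetric] poly_f5_inv uq uqq uh
    unfolding u using nz assms(4) by (rule f5_inverse_identity)
qed

theorem theorem3p5:
  fixes p m q :: nat
  assumes "prime p" and "odd p" and "m > 0" and "q = p ^ m"
    and "CARD('a::{field,finite}) = q ^ 3"
  shows "permutation_poly (f5 q :: 'a poly) \<and>
         compositional_inverse (f5 q :: 'a poly) (f5_inv q)"
proof -
  have "CARD('a) = p ^ (m * 3)"
    using assms(4,5) by (simp add: power_mult)
  with \<open>prime p\<close> have char: "CHAR('a) = p"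
    by (rule CHAR_eq_prime)
  have frobenius: "(a + b) ^ q = a ^ q + b ^ q" for a b :: 'a
    by (rule freshmans_dream'[of _ m]) (use assms(1,4) char in simp_all)
  \<comment> \<open>Oddness of \<open>p\<close> makes 4 invertible in the field, as the factor 1/4
    of the inverse requires.\<close>
  have "\<not> p dvd 2 ^ 2"
    using assms(1,2) by (metis prime_dvd_power primes_dvd_imp_eq two_is_prime_nat)
  then have "of_nat (2 ^ 2) \<noteq> (0 :: 'a)"
    by (simp only: of_nat_eq_0_iff_char_dvd char not_False_eq_True)
  then have "(4 :: 'a) \<noteq> 0"
    by simp
  moreover have "odd q"
    using assms(2,4) by simp
  ultimately have left: "poly (f5_inv q) (poly (f5 q) x) = x" for x :: 'a
    using f5_inv_f5[OF _ frobenius assms(5)] by blast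
  show ?thesis
    unfolding permutation_poly_def compositional_inverse_def
    using left left_inverse_finite_imp_right_inverse[of "poly (f5_inv q)" "poly (f5 q)", OF left]
    by blast
qed

end
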